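(* Let $n\in\mathbb{N}$, $n\ge 1$, and let $D\subset\mathbb{C}^n$ be a bounded, convex domain. Let $\mathcal{Y}$ be a functional Hilbert space of holomorphic functions on $D$ with reproducing kernel $K:D\times D\to\mathbb{C}$. Assume that $K(z,z)\to\infty$ as $z\to\partial D$, and that the polynomial functions on $D$ are contained in $\mathcal{Y}$ and are dense in $\mathcal{Y}$. Let $\psi:D\to\mathbb{C}$ be holomorphic and bounded away from zero toward the boundary of $D$, and let $\phi:D\to D$ be holomorphic. Assume that the weighted composition operator $W_{\psi,\phi}$, given by $W_{\psi,\phi}(f)=\psi\,(f\circ\phi)$, is compact on $\mathcal{Y}$. Then $\phi$ has a unique fixed point in $D$.
   Context: A functional Hilbert space of holomorphic functions on $D$ is a complex Hilbert space $\mathcal{Y}$ whose elements are holomorphic functions $f:D\to\mathbb{C}$ (with pointwise vector space operations) such that for each $z\in D$ the evaluation $f\mapsto f(z)$ is a bounded linear functional on $\mathcal{Y}$. By the Riesz representation theorem, for each $z\in D$ there is a unique $K_z\in\mathcal{Y}$ with $f(z)=\langle f,K_z\rangle$ for all $f\in\mathcal{Y}$; the reproducing kernel of $\mathcal{Y}$ is $K:D\times D\to\mathbb{C}$, $K(z,w)=K_z(w)$. In particular $K(z,z)=\|K_z\|_{\mathcal{Y}}^2\ge 0$. Write $d(z,A)$ for the Euclidean distance from $z\in\mathbb{C}^n$ to $A\subset\mathbb{C}^n$; $z\to\partial D$ means $d(z,\partial D)\to 0$ (with $z\in D$). Thus $K(z,z)\to\infty$ as $z\to\partial D$ means: for every $M>0$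 there is $\delta>0$ such that $K(z,z)>M$ for all $z\in D$ with $d(z,\partial D)<\delta$. For $u:D\to\mathbb{R}$ and $\nu\in\mathbb{R}$, write $\liminf_{z\to\partial D}u(z)=\nu$ if for every $\varepsilon>0$ there is $\delta>0$ such that $\left|\inf_{\{z\in D:\,d(z,\partial D)<\delta\}}u(z)-\nu\right|<\varepsilon$. The function $\psi:D\to\mathbb{C}$ is bounded away from zero toward the boundary of $D$ if there is $\nu>0$ such that $\liminf_{z\to\partial D}|\psi(z)|=\nu$. "$W_{\psi,\phi}$ is compact on $\mathcal{Y}$" means that $W_{\psi,\phi}$ maps $\mathcal{Y}$ into $\mathcal{Y}$ and is a compact linear operator on $\mathcal{Y}$. *)

theory Defs
  imports "HOL-Analysis.Analysis"
begin

text \<open>Holomorphy in several variables: Frechet differentiability with complex-linear derivative.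
  Meant for open \<open>D\<close>.\<close>

definition holomorphic_several :: "(complex ^ 'n) set \<Rightarrow> (complex ^ 'n \<Rightarrow> complex) \<Rightarrow> bool" where
  "holomorphic_several D f \<longleftrightarrow>
     (\<forall>z\<in>D. \<exists>f'. (f has_derivative f') (at z) \<and> (\<forall>c v. f' (c *s v) = c * f' v))"

definition holomorphic_map ::
    "(complex ^ 'n) set \<Rightarrow> (complex ^ 'n \<Rightarrow> complex ^ 'm) \<Rightarrow> bool" where
  "holomorphic_map D \<phi> \<longleftrightarrow> (\<forall>i. holomorphic_several D (\<lambda>z. \<phi> z $ i))"

text \<open>A function on \<open>D\<close> is represented by the total function that extends it by zero, so that
  equality of representatives is equality on \<open>D\<close> and the pointwise operations are the ones on
  total functions.\<close>

definition zero_ext :: "'a set \<Rightarrow> ('a \<Rightarrow> complex) \<Rightarrow> 'a \<Rightarrow> complex" where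
  "zero_ext D f = (\<lambda>z. if z \<in> D then f z else 0)"

definition polynomial_functions :: "(complex ^ 'n) set \<Rightarrow> (complex ^ 'n \<Rightarrow> complex) set" where
  "polynomial_functions D =
     {zero_ext D (\<lambda>z. \<Sum>\<alpha>\<in>S. c \<alpha> * (\<Prod>i\<in>UNIV. (z $ i) ^ \<alpha> i)) | c (S :: ('n \<Rightarrow> nat) set). finite S}"

definition ip_norm :: "(('a \<Rightarrow> complex) \<Rightarrow> ('a \<Rightarrow> complex) \<Rightarrow> complex) \<Rightarrow> ('a \<Rightarrow> complex) \<Rightarrow> real" where
  "ip_norm ip f = sqrt (Re (ip f f))"

definition ip_dist ::
    "(('a \<Rightarrow> complex) \<Rightarrow> ('a \<Rightarrow> complex) \<Rightarrow> complex) \<Rightarrow> ('a \<Rightarrow> complex) \<Rightarrow> ('a \<Rightarrow> complex) \<Rightarrow> real" where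
  "ip_dist ip f g = ip_norm ip (\<lambda>z. f z - g z)"

text \<open>\<open>Y\<close> is the underlying set of functions and \<open>ip\<close> its inner product, linear in the
  first argument; the values of \<open>ip\<close> outside \<open>Y\<close> are irrelevant.\<close>

locale functional_hilbert_space =
  fixes D :: "(complex ^ 'n) set"
    and Y :: "(complex ^ 'n \<Rightarrow> complex) set"
    and ip :: "(complex ^ 'n \<Rightarrow> complex) \<Rightarrow> (complex ^ 'n \<Rightarrow> complex) \<Rightarrow> complex"
  assumes holomorphic: "f \<in> Y \<Longrightarrow> holomorphic_several D f"
    and zero_outside: "f \<in> Y \<Longrightarrow> z \<notin> D \<Longrightarrow> f z = 0"
    and zero_mem: "(\<lambda>z. 0) \<in> Y"
    and add_mem: "f \<in> Y \<Longrightarrow> g \<in> Y \<Longrightarrow> (\<lambda>z. f z + g z) \<in> Y"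
    and scale_mem: "f \<in> Y \<Longrightarrow> (\<lambda>z. c * f z) \<in> Y"
    and ip_add_left:
      "f \<in> Y \<Longrightarrow> g \<in> Y \<Longrightarrow> h \<in> Y \<Longrightarrow> ip (\<lambda>z. f z + g z) h = ip f h + ip g h"
    and ip_scale_left: "f \<in> Y \<Longrightarrow> g \<in> Y \<Longrightarrow> ip (\<lambda>z. c * f z) g = c * ip f g"
    and ip_commute: "f \<in> Y \<Longrightarrow> g \<in> Y \<Longrightarrow> ip f g = cnj (ip g f)"
    and ip_nonneg: "f \<in> Y \<Longrightarrow> 0 \<le> Re (ip f f)"
    and ip_definite: "f \<in> Y \<Longrightarrow> ip f f = 0 \<Longrightarrow> f = (\<lambda>z. 0)"
    and complete:
      "(\<forall>k :: nat. F k \<in> Y) \<Longrightarrow> (\<forall>e>0. \<exists>N. \<forall>j\<ge>N. \<forall>k\<ge>N. ip_dist ip (F j) (F k) < e) \<Longrightarrow>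
         \<exists>f\<in>Y. (\<lambda>k. ip_dist ip (F k) f) \<longlonglongrightarrow> 0"
    and evaluation_bounded: "z \<in> D \<Longrightarrow> \<exists>C. \<forall>f\<in>Y. norm (f z) \<le> C * ip_norm ip f"

definition reproducing_kernel ::
    "'a set \<Rightarrow> ('a \<Rightarrow> complex) set \<Rightarrow> (('a \<Rightarrow> complex) \<Rightarrow> ('a \<Rightarrow> complex) \<Rightarrow> complex) \<Rightarrow>
     ('a \<Rightarrow> 'a \<Rightarrow> complex) \<Rightarrow> bool" where
  "reproducing_kernel D Y ip K \<longleftrightarrow> (\<forall>z\<in>D. K z \<in> Y \<and> (\<forall>f\<in>Y. f z = ip f (K z)))"

definition dense_in_fhs ::
    "('a \<Rightarrow> complex) set \<Rightarrow> (('a \<Rightarrow> complex) \<Rightarrow> ('a \<Rightarrow> complex) \<Rightarrow> complex) \<Rightarrow>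
     ('a \<Rightarrow> complex) set \<Rightarrow> bool" where
  "dense_in_fhs Y ip P \<longleftrightarrow> (\<forall>f\<in>Y. \<forall>e>0. \<exists>p\<in>P. ip_dist ip f p < e)"

definition tends_to_infinity_at_boundary :: "(complex ^ 'n) set \<Rightarrow> (complex ^ 'n \<Rightarrow> real) \<Rightarrow> bool" where
  "tends_to_infinity_at_boundary D u \<longleftrightarrow>
     (\<forall>M>0. \<exists>\<delta>>0. \<forall>z\<in>D. infdist z (frontier D) < \<delta> \<longrightarrow> M < u z)"

text \<open>The infimum is taken in \<open>ereal\<close>, as it may be \<open>-\<infinity>\<close>.\<close>

definition liminf_at_boundary :: "(complex ^ 'n) set \<Rightarrow> (complex ^ 'n \<Rightarrow> real) \<Rightarrow> real \<Rightarrow> bool" where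
  "liminf_at_boundary D u \<nu> \<longleftrightarrow>
     (\<forall>\<epsilon>>0. \<exists>\<delta>>0.
        \<bar>(INF z\<in>{z \<in> D. infdist z (frontier D) < \<delta>}. ereal (u z)) - ereal \<nu>\<bar> < ereal \<epsilon>)"

definition bounded_away_from_zero_at_boundary ::
    "(complex ^ 'n) set \<Rightarrow> (complex ^ 'n \<Rightarrow> complex) \<Rightarrow> bool" where
  "bounded_away_from_zero_at_boundary D \<psi> \<longleftrightarrow>
     (\<exists>\<nu>>0. liminf_at_boundary D (\<lambda>z. norm (\<psi> z)) \<nu>)"

definition weighted_composition ::
    "'a set \<Rightarrow> ('a \<Rightarrow> complex) \<Rightarrow> ('a \<Rightarrow> 'a) \<Rightarrow> ('a \<Rightarrow> complex) \<Rightarrow> 'a \<Rightarrow> complex" where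
  "weighted_composition D \<psi> \<phi> f = zero_ext D (\<lambda>z. \<psi> z * f (\<phi> z))"

definition compact_operator ::
    "('a \<Rightarrow> complex) set \<Rightarrow> (('a \<Rightarrow> complex) \<Rightarrow> ('a \<Rightarrow> complex) \<Rightarrow> complex) \<Rightarrow>
     (('a \<Rightarrow> complex) \<Rightarrow> 'a \<Rightarrow> complex) \<Rightarrow> bool" where
  "compact_operator Y ip T \<longleftrightarrow>
     (\<forall>f\<in>Y. T f \<in> Y) \<and>
     (\<forall>f\<in>Y. \<forall>g\<in>Y. T (\<lambda>z. f z + g z) = (\<lambda>z. T f z + T g z)) \<and>
     (\<forall>c. \<forall>f\<in>Y. T (\<lambda>z. c * f z) = (\<lambda>z. c * T f z)) \<and>
     (\<forall>F :: nat \<Rightarrow> 'a \<Rightarrow> complex. (\<forall>k. F k \<in> Y) \<and> (\<exists>C. \<forall>k. ip_norm ip (F k) \<le> C) \<longrightarrow>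
        (\<exists>r g. strict_mono r \<and> g \<in> Y \<and> (\<lambda>k. ip_dist ip (T (F (r k))) g) \<longlonglongrightarrow> 0))"

end

theory Submission
  imports Defs "HOL-Complex_Analysis.Conformal_Mappings"
begin

text \<open>
  The operator enters only through an estimate of the kernel near the boundary. Testing
  the operator \<open>W\<close> on the normalised kernels at the points \<open>\<phi> z\<close> and using compactness gives
  \<open>|\<psi> z|\<^sup>2 K(\<phi> z, \<phi> z) / K(z, z) \<rightarrow> 0\<close> as \<open>z\<close> tends to the boundary, because normalised
  point evaluations tend to zero on bounded functions and hence, by density of the polynomials,
  on all of \<open>Y\<close>. As \<open>\<psi>\<close> is bounded away from zero there, \<open>\<phi>\<close> at least halves \<open>K(z, z)\<close>
  near the boundary (\<open>kernel_halving_near_boundary\<close>).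

  Since \<open>K(z, z) > 1\<close> near the boundary, halving cannot go on forever, so every orbit of
  \<open>\<phi>\<close> meets a fixed relatively compact open subset of \<open>D\<close>. A covering argument turns this
  into a \<open>\<phi>\<close>-invariant compact set \<open>M \<subseteq> D\<close> that absorbs each compact subset of \<open>D\<close> after
  finitely many steps (\<open>recurrent_imp_absorbing_compact\<close>).

  Let \<open>C\<close> be the convex hull of \<open>M\<close>, which lies in \<open>D\<close> by convexity, and let \<open>S\<close> be a
  neighbourhood of \<open>C\<close> that is relatively compact in \<open>D\<close>. Some iterate \<open>\<Phi>\<close> of \<open>\<phi>\<close> maps
  \<open>S\<close> into \<open>C\<close>, so it has exactly one fixed point in \<open>S\<close> by the theorem of Earle and
  Hamilton (\<open>earle_hamilton\<close>). As \<open>\<phi>\<close> commutes with \<open>\<Phi>\<close>, this point is fixed by \<open>\<phi>\<close>; and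
  since every fixed point of \<open>\<phi>\<close> lies in the absorbing set, there is no other one.

  The theorem of Earle and Hamilton is derived from the Harnack inequality. For a holomorphic
  \<open>g\<close> the suprema of \<open>Re (g \<circ> \<Phi>\<^sup>j)\<close> over \<open>S\<close> decrease to a limit. Each of them is nearly
  attained by \<open>Re (g \<circ> \<Phi>\<^sup>j\<^sup>-\<^sup>1)\<close> at a point of \<open>C\<close>, so Harnack forces the latter function to be
  close to the limit on all of \<open>C\<close>. With \<open>g\<close> a coordinate, the iterates of \<open>\<Phi>\<close> converge on
  \<open>C\<close> to a single point.
\<close>

section \<open>The Harnack inequality along a segment\<close>

text \<open>The Cayley transform turns \<open>h\<close> into a self-map of the unit disc that fixes the origin;
  the Schwarz lemma at distance \<open>1/2\<close> gives the factor \<open>(1 + 1/2) / (1 - 1/2) = 3\<close>.\<close>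

lemma harnack_ball:
  fixes h :: "complex \<Rightarrow> complex"
  assumes hol: "h holomorphic_on ball a r" and pos: "\<And>z. z \<in> ball a r \<Longrightarrow> 0 \<le> Re (h z)"
    and b: "dist a b \<le> r / 2" and r: "0 < r"
  shows "Re (h b) \<le> 3 * Re (h a)"
proof -
  \<comment> \<open>Adding a small constant makes the real part strictly positive, as the Cayley transform
    requires.\<close>
  have shifted: "Re (h b) + e \<le> 3 * (Re (h a) + e)" if e: "0 < e" for e
  proof -
    define F where "F \<zeta> = h (a + of_real r * \<zeta>) + of_real e" for \<zeta>
    define G where "G \<zeta> = (F \<zeta> - F 0) / (F \<zeta> + cnj (F 0))" for \<zeta>
    have inball: "a + of_real r * \<zeta> \<in> ball a r" if "norm \<zeta> < 1" for \<zeta>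
      using that r by (simp add: dist_norm norm_mult)
    have F_pos: "0 < Re (F \<zeta>)" if "norm \<zeta> < 1" for \<zeta>
      using pos[OF inball[OF that]] e by (simp add: F_def)
    have F_hol: "F holomorphic_on ball 0 1"
      unfolding F_def using inball
      by (intro holomorphic_intros holomorphic_on_compose_gen[OF _ hol, unfolded o_def]) auto
    have denom: "F \<zeta> + cnj (F 0) \<noteq> 0" if "norm \<zeta> < 1" for \<zeta>
    proof -
      have "0 < Re (F \<zeta> + cnj (F 0))" using F_pos[OF that] F_pos[of 0] by simp
      then show ?thesis by (metis less_irrefl zero_complex.simps(1))
    qed
    have G_hol: "G holomorphic_on ball 0 1"
      unfolding G_def using denom by (intro holomorphic_intros F_hol) auto
    have G_lt: "norm (G \<zeta>) < 1" if \<zeta>: "norm \<zeta> < 1" for \<zeta>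
    proof -
      have "0 < Re (F \<zeta>) * Re (F 0)" using F_pos[OF \<zeta>] F_pos[of 0] by simp
      then have "(norm (F \<zeta> - F 0))\<^sup>2 < (norm (F \<zeta> + cnj (F 0)))\<^sup>2"
        unfolding cmod_power2 by (simp add: power2_eq_square algebra_simps)
      then have "norm (F \<zeta> - F 0) < norm (F \<zeta> + cnj (F 0))"
        by (rule power2_less_imp_less) simp
      then show ?thesis using denom[OF \<zeta>] by (simp add: G_def norm_divide)
    qed
    define w where "w = (b - a) / of_real r"
    have w: "norm w \<le> 1 / 2"
      using b r by (simp add: w_def norm_divide dist_norm norm_minus_commute field_simps)
    have "norm (G w) \<le> 1 / 2"
      using Schwarz_Lemma(1)[OF G_hol _ G_lt, of w] w by (simp add: G_def)
    then have "norm (F w - F 0) \<le> norm (F w + cnj (F 0)) / 2"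
      using denom[of w] w by (simp add: G_def norm_divide field_simps)
    then have "(norm (F w - F 0))\<^sup>2 \<le> (norm (F w + cnj (F 0)) / 2)\<^sup>2"
      by (rule power_mono) simp
    then have "4 * ((Re (F w) - Re (F 0))\<^sup>2 + (Im (F w) - Im (F 0))\<^sup>2)
        \<le> (Re (F w) + Re (F 0))\<^sup>2 + (Im (F w) - Im (F 0))\<^sup>2"
      unfolding power_divide cmod_power2 by simp
    moreover have "4 * p \<le> r" if "4 * (p + q) \<le> r + q" and "0 \<le> q" for p q r :: real
      using that by argo
    ultimately have "4 * (Re (F w) - Re (F 0))\<^sup>2 \<le> (Re (F w) + Re (F 0))\<^sup>2"
      using zero_le_power2 by blast
    moreover have double_square: "(2 * d)\<^sup>2 = 4 * d\<^sup>2" for d :: real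
      by (simp add: power_mult_distrib)
    ultimately have "(2 * (Re (F w) - Re (F 0)))\<^sup>2 \<le> (Re (F w) + Re (F 0))\<^sup>2"
      by (simp only: double_square)
    then have "2 * (Re (F w) - Re (F 0)) \<le> Re (F w) + Re (F 0)"
    proof (rule power2_le_imp_le)
      have "0 < Re (F w)" and "0 < Re (F 0)" using w by (auto intro: F_pos)
      then show "0 \<le> Re (F w) + Re (F 0)" by simp
    qed
    then have "Re (F w) \<le> 3 * Re (F 0)" by argo
    moreover have "F w = h b + of_real e" using r by (simp add: F_def w_def)
    moreover have "F 0 = h a + of_real e" by (simp add: F_def)
    ultimately show ?thesis by simp
  qed
  show ?thesis
  proof (rule field_le_epsilon)
    fix e :: real assume "0 < e"
    then show "Re (h b) \<le> 3 * Re (h a) + e" using shifted[of "e / 2"] by simp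
  qed
qed

text \<open>The segment is walked in \<open>N\<close> steps of length at most \<open>r / 2\<close>, each costing a factor \<open>3\<close>.
  It matters that the constant depends only on the width \<open>r\<close> of the neighbourhood.\<close>

lemma harnack_segment:
  fixes h :: "complex \<Rightarrow> complex"
  assumes hol: "h holomorphic_on U" and pos: "\<And>z. z \<in> U \<Longrightarrow> 0 \<le> Re (h z)"
    and balls: "\<And>t. 0 \<le> t \<Longrightarrow> t \<le> 1 \<Longrightarrow> ball (complex_of_real t) r \<subseteq> U"
    and N: "2 / r \<le> real N" and r: "0 < r"
  shows "Re (h 1) \<le> 3 ^ N * Re (h 0)"
proof -
  have N0: "0 < N" using N r by (cases "N = 0") (auto simp: divide_le_0_iff)
  have "k \<le> N \<Longrightarrow> Re (h (of_real (real k / real N))) \<le> 3 ^ k * Re (h 0)" for k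
  proof (induction k)
    case (Suc k)
    let ?a = "complex_of_real (real k / real N)" and ?b = "complex_of_real (real (Suc k) / real N)"
    have sub: "ball ?a r \<subseteq> U" using Suc.prems N0 by (intro balls) auto
    have "dist ?a ?b = 1 / real N"
      unfolding dist_of_real dist_real_def using N0 by (simp add: field_simps)
    also have "\<dots> \<le> r / 2" using N r N0 by (simp add: field_simps)
    finally have "dist ?a ?b \<le> r / 2" .
    then have "Re (h ?b) \<le> 3 * Re (h ?a)"
      using sub hol pos r by (intro harnack_ball[of h ?a r]) (auto intro: holomorphic_on_subset)
    also have "\<dots> \<le> 3 * (3 ^ k * Re (h 0))" using Suc by simp
    finally show ?case by simp
  qed simp
  from this[of N] show ?thesis using N0 by simp
qed

section \<open>Holomorphic functions of several variables\<close>

lemma has_derivative_vec_componentwise: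
  fixes f :: "'a::real_normed_vector \<Rightarrow> complex ^ 'm"
  assumes "\<And>i. ((\<lambda>x. f x $ i) has_derivative f' i) (at x)"
  shows "(f has_derivative (\<lambda>v. \<chi> i. f' i v)) (at x)"
proof -
  have "((\<lambda>y. f y \<bullet> b) has_derivative (\<lambda>v. (\<chi> i. f' i v) \<bullet> b)) (at x)" if "b \<in> Basis" for b
  proof -
    from that obtain i u where b: "b = axis i u" by (auto simp: Basis_vec_def)
    show ?thesis
      unfolding b inner_axis using assms[of i] by (auto intro!: derivative_eq_intros)
  qed
  then show ?thesis by (subst has_derivative_componentwise_within) blast
qed

lemma holomorphic_several_continuous_on:
  "holomorphic_several S g \<Longrightarrow> continuous_on S g"
  unfolding holomorphic_several_def
  by (meson continuous_at_imp_continuous_on has_derivative_continuous)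

lemma holomorphic_map_continuous_on:
  assumes "holomorphic_map S \<phi>"
  shows "continuous_on S \<phi>"
proof -
  have "continuous_on S (\<lambda>z. \<chi> i. \<phi> z $ i)"
    using assms unfolding holomorphic_map_def
    by (intro continuous_on_vec_lambda holomorphic_several_continuous_on) auto
  then show ?thesis by simp
qed

lemma holomorphic_several_coordinate:
  fixes i :: "'n::finite"
  shows "holomorphic_several S (\<lambda>z. z $ i)"
  unfolding holomorphic_several_def
proof
  fix z :: "complex ^ 'n"
  have "((\<lambda>z. z $ i) has_derivative (\<lambda>z. z $ i)) (at z)"
    by (intro bounded_linear_imp_has_derivative bounded_linear_vec_nth)
  then show "\<exists>f'. ((\<lambda>z. z $ i) has_derivative f') (at z) \<and> (\<forall>c v. f' (c *s v) = c * f' v)"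
    by (intro exI[of _ "\<lambda>z. z $ i"]) simp
qed

lemma holomorphic_several_affine:
  assumes "holomorphic_several S g"
  shows "holomorphic_several S (\<lambda>z. a + c * g z)"
  unfolding holomorphic_several_def
proof
  fix z assume "z \<in> S"
  then obtain g' where g': "(g has_derivative g') (at z)" "\<And>c v. g' (c *s v) = c * g' v"
    using assms unfolding holomorphic_several_def by blast
  have "((\<lambda>z. a + c * g z) has_derivative (\<lambda>v. c * g' v)) (at z)"
    using g'(1) by (auto intro!: derivative_eq_intros)
  then show "\<exists>f'. ((\<lambda>z. a + c * g z) has_derivative f') (at z) \<and> (\<forall>c v. f' (c *s v) = c * f' v)"
    by (intro exI[of _ "\<lambda>v. c * g' v"]) (simp add: g'(2))
qed

lemma holomorphic_several_compose:
  assumes \<phi>: "holomorphic_map S \<phi>" and g: "holomorphic_several T g" and sub: "\<phi> ` S \<subseteq> T"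
  shows "holomorphic_several S (\<lambda>z. g (\<phi> z))"
  unfolding holomorphic_several_def
proof
  fix z assume z: "z \<in> S"
  have "\<forall>i. \<exists>f'. ((\<lambda>z. \<phi> z $ i) has_derivative f') (at z) \<and> (\<forall>c v. f' (c *s v) = c * f' v)"
    using \<phi> z by (auto simp: holomorphic_map_def holomorphic_several_def)
  then obtain f' where f': "\<And>i. ((\<lambda>z. \<phi> z $ i) has_derivative f' i) (at z)"
      "\<And>i c v. f' i (c *s v) = c * f' i v" by metis
  obtain g' where g': "(g has_derivative g') (at (\<phi> z))" "\<And>c v. g' (c *s v) = c * g' v"
    using g z sub unfolding holomorphic_several_def by blast
  have "((\<lambda>z. g (\<phi> z)) has_derivative (\<lambda>v. g' (\<chi> i. f' i v))) (at z)"
    by (rule has_derivative_compose[OF has_derivative_vec_componentwise[OF f'(1)] g'(1)])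
  moreover have "(\<chi> i. f' i (c *s v)) = c *s (\<chi> i. f' i v)" for c v
    by (simp add: vec_eq_iff f'(2))
  ultimately show "\<exists>f'. ((\<lambda>z. g (\<phi> z)) has_derivative f') (at z) \<and> (\<forall>c v. f' (c *s v) = c * f' v)"
    by (metis g'(2))
qed

lemma holomorphic_map_funpow:
  assumes \<phi>: "holomorphic_map S \<phi>" and sub: "\<phi> ` S \<subseteq> S"
  shows "holomorphic_map S (\<phi> ^^ k)"
proof (induction k)
  case 0
  show ?case
    by (simp add: holomorphic_map_def holomorphic_several_coordinate)
next
  case (Suc k)
  then show ?case
    using holomorphic_several_compose[OF \<phi> _ sub] unfolding holomorphic_map_def
    by (simp only: funpow_Suc_right o_apply) blast
qed

lemma holomorphic_several_along_line:
  assumes g: "holomorphic_several S g"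
  shows "(\<lambda>\<zeta>. g (x + \<zeta> *s v)) holomorphic_on {\<zeta>. x + \<zeta> *s v \<in> S}"
proof (rule holomorphic_onI)
  fix \<zeta> assume "\<zeta> \<in> {\<zeta>. x + \<zeta> *s v \<in> S}"
  then obtain g' where g': "(g has_derivative g') (at (x + \<zeta> *s v))" "\<And>c v. g' (c *s v) = c * g' v"
    using g unfolding holomorphic_several_def by blast
  have "((\<lambda>\<zeta>. x + \<zeta> *s v) has_derivative (\<lambda>\<xi>. \<chi> i. \<xi> * v $ i)) (at \<zeta>)"
    by (rule has_derivative_vec_componentwise) (auto intro!: derivative_eq_intros)
  from has_derivative_compose[OF this g'(1)]
  have "((\<lambda>\<zeta>. g (x + \<zeta> *s v)) has_derivative (\<lambda>\<xi>. g' v * \<xi>)) (at \<zeta>)"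
    using g'(2)[of _ v] by (simp add: vector_scalar_mult_def mult.commute)
  then have "((\<lambda>\<zeta>. g (x + \<zeta> *s v)) has_field_derivative g' v) (at \<zeta>)"
    by (simp add: has_field_derivative_def)
  then show "(\<lambda>\<zeta>. g (x + \<zeta> *s v)) field_differentiable at \<zeta> within {\<zeta>. x + \<zeta> *s v \<in> S}"
    using field_differentiable_at_within field_differentiable_def by blast
qed

lemma norm_scalar_mult_vec: "norm (c *s (v :: complex ^ 'n)) = norm c * norm v"
  by (simp add: norm_vec_def norm_mult L2_set_right_distrib)

text \<open>Two points of \<open>C\<close> are joined by the complex affine line through them. The parameters that
  this line maps into \<open>S\<close> contain a neighbourhood of \<open>[0, 1]\<close> whose width depends only on the
  distance of \<open>C\<close> to the complement of \<open>S\<close> and on the size of \<open>C\<close>, so one constant serves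
  all pairs of points and all functions.\<close>

lemma harnack_compact_convex:
  fixes C S :: "(complex ^ 'n) set"
  assumes "open S" and "compact C" and "convex C" and "C \<subseteq> S"
  obtains H where "0 < H"
    and "\<And>g x y. holomorphic_several S g \<Longrightarrow> (\<And>z. z \<in> S \<Longrightarrow> 0 \<le> Re (g z)) \<Longrightarrow>
           x \<in> C \<Longrightarrow> y \<in> C \<Longrightarrow> Re (g y) \<le> H * Re (g x)"
proof -
  obtain e where e: "0 < e" "(\<Union>x\<in>C. ball x e) \<subseteq> S"
    using compact_subset_open_imp_ball_epsilon_subset[OF assms(2,1,4)] by auto
  obtain B where B: "0 < B" "\<And>x. x \<in> C \<Longrightarrow> norm x \<le> B"
    using compact_imp_bounded[OF assms(2)] bounded_pos by blast
  define r where "r = e / (2 * B)"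
  have r: "0 < r" using e B by (simp add: r_def)
  obtain N :: nat where N: "2 / r \<le> real N" using real_arch_simple by blast
  show thesis
  proof
    show "(0::real) < 3 ^ N" by simp
    fix g x y
    assume g: "holomorphic_several S g" and pos: "\<And>z. z \<in> S \<Longrightarrow> 0 \<le> Re (g z)"
      and x: "x \<in> C" and y: "y \<in> C"
    define h where "h \<zeta> = g (x + \<zeta> *s (y - x))" for \<zeta>
    have "Re (h 1) \<le> 3 ^ N * Re (h 0)"
    proof (rule harnack_segment)
      show "h holomorphic_on {\<zeta>. x + \<zeta> *s (y - x) \<in> S}"
        unfolding h_def by (rule holomorphic_several_along_line[OF g])
      show "ball (complex_of_real t) r \<subseteq> {\<zeta>. x + \<zeta> *s (y - x) \<in> S}" if t: "0 \<le> t" "t \<le> 1" for t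
      proof
        fix \<zeta> assume "\<zeta> \<in> ball (complex_of_real t) r"
        then have \<zeta>: "norm (\<zeta> - of_real t) < r" by (simp add: dist_norm norm_minus_commute)
        have p: "x + of_real t *s (y - x) \<in> C"
        proof -
          have "x + of_real t *s (y - x) = (1 - t) *\<^sub>R x + t *\<^sub>R y"
            by (simp add: vec_eq_iff complex_eq_iff algebra_simps)
          then show ?thesis using convexD_alt[OF assms(3) x y] t by auto
        qed
        have "(x + \<zeta> *s (y - x)) - (x + of_real t *s (y - x)) = (\<zeta> - of_real t) *s (y - x)"
          by (simp add: vec_eq_iff algebra_simps)
        then have "dist (x + of_real t *s (y - x)) (x + \<zeta> *s (y - x))
            = norm (\<zeta> - of_real t) * norm (y - x)"
          by (metis dist_commute dist_norm norm_scalar_mult_vec)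
        also have "\<dots> \<le> norm (\<zeta> - of_real t) * (2 * B)"
          using B(2)[OF x] B(2)[OF y] norm_triangle_ineq4[of y x] by (intro mult_left_mono) auto
        also have "\<dots> < r * (2 * B)" using \<zeta> B by simp
        also have "\<dots> = e" using B by (simp add: r_def)
        finally have "x + \<zeta> *s (y - x) \<in> ball (x + of_real t *s (y - x)) e"
          by (simp only: mem_ball)
        then show "\<zeta> \<in> {\<zeta>. x + \<zeta> *s (y - x) \<in> S}" using p e(2) by blast
      qed
    qed (use pos r N in \<open>auto simp: h_def\<close>)
    then show "Re (g y) \<le> 3 ^ N * Re (g x)" by (simp add: h_def)
  qed
qed

section \<open>The fixed point theorem of Earle and Hamilton\<close>

text \<open>Write \<open>u j\<close> for \<open>Re (g \<circ> \<psi>\<^sup>j\<^sup>+\<^sup>1)\<close> and \<open>s j\<close> for its supremum over \<open>S\<close>. Then \<open>s j - u j\<close> is the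
  nonnegative real part of a holomorphic function on \<open>S\<close>. Since \<open>u (j + 1) = u j \<circ> \<psi>\<close> and
  \<open>\<psi>\<close> maps into \<open>C\<close>, the function \<open>s j - u j\<close> takes at some point of \<open>C\<close> a value not much
  larger than \<open>s j - s (j + 1)\<close>, which tends to \<open>0\<close> because the \<open>s j\<close> decrease to a limit. By Harnack \<open>s j - u j\<close> tends to \<open>0\<close> on all of \<open>C\<close>,
  so the limit of \<open>u j\<close> is that of \<open>s j\<close> and does not depend on the point.\<close>

lemma iterates_compact_image_converge:
  fixes \<psi> :: "complex ^ 'n \<Rightarrow> complex ^ 'n"
  assumes "open S" and "compact C" and "convex C" and "C \<subseteq> S" and "C \<noteq> {}"
    and \<psi>: "holomorphic_map S \<psi>" and img: "\<psi> ` S \<subseteq> C"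
    and g: "holomorphic_several S g"
  obtains s where "\<And>y. y \<in> C \<Longrightarrow> (\<lambda>j. Re (g ((\<psi> ^^ j) y))) \<longlonglongrightarrow> s"
proof -
  have self: "\<psi> ` S \<subseteq> S" using img assms(4) by blast
  have powS: "(\<psi> ^^ j) z \<in> S" if "z \<in> S" for j z
    using that self by (induction j) auto
  have powC: "(\<psi> ^^ Suc j) z \<in> C" if "z \<in> S" for j z
    using powS[OF that, of j] img by auto
  obtain H where H: "0 < H"
    and harnack: "\<And>g x y. holomorphic_several S g \<Longrightarrow> (\<And>z. z \<in> S \<Longrightarrow> 0 \<le> Re (g z)) \<Longrightarrow>
           x \<in> C \<Longrightarrow> y \<in> C \<Longrightarrow> Re (g y) \<le> H * Re (g x)"
    using harnack_compact_convex[OF assms(1-4)] by metis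
  \<comment> \<open>Starting with the first iterate, not with the identity, keeps the values in the compact
    set \<open>g ` C\<close>, so that the suprema are finite.\<close>
  define u where "u j z = Re (g ((\<psi> ^^ Suc j) z))" for j z
  define s where "s j = (SUP z\<in>S. u j z)" for j
  have "compact (g ` C)"
    using holomorphic_several_continuous_on[OF g] assms(2,4)
    by (intro compact_continuous_image) (auto intro: continuous_on_subset)
  then obtain B where B: "\<And>z. z \<in> C \<Longrightarrow> norm (g z) \<le> B"
    using compact_imp_bounded bounded_iff by (metis imageI)
  have u_abs: "\<bar>u j z\<bar> \<le> B" if "z \<in> S" for j z
    using B[OF powC[OF that, of j]] abs_Re_le_cmod order_trans unfolding u_def by blast
  have bdd: "bdd_above (u j ` S)" for j
    using u_abs by (intro bdd_aboveI2[where M=B]) (auto simp: abs_le_iff)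
  have S_ne: "S \<noteq> {}" using assms(4,5) by blast
  have u_le: "u j z \<le> s j" if "z \<in> S" for j z
    unfolding s_def using bdd that by (rule cSUP_upper2) auto
  have u_Suc: "u (Suc j) z = u j (\<psi> z)" for j z
    unfolding u_def by (simp only: funpow_Suc_right o_apply)
  have s_decr: "s (Suc j) \<le> s j" for j
    unfolding s_def[of "Suc j"] using S_ne self
    by (intro cSUP_least) (auto simp: u_Suc intro!: u_le)
  have "- B \<le> s j" for j
    using S_ne u_abs u_le abs_le_D2 by (metis all_not_in_conv minus_le_iff order_trans)
  then obtain t where t: "s \<longlonglongrightarrow> t"
    using decseq_convergent[of s "- B"] s_decr by (metis decseq_SucI)
  have lower: "s j - H * (s j - s (Suc j) + inverse (real (Suc j))) \<le> u j y" if y: "y \<in> C" for j y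
  proof -
    \<comment> \<open>The supremum need not be attained; the slack \<open>inverse (Suc j)\<close> provides a point near it.\<close>
    have "\<exists>z\<in>S. s (Suc j) - inverse (real (Suc j)) < u (Suc j) z"
    proof (subst less_cSUP_iff[OF S_ne bdd, symmetric])
      show "s (Suc j) - inverse (real (Suc j)) < (SUP z\<in>S. u (Suc j) z)"
        unfolding s_def[symmetric] by simp
    qed
    then obtain z where z: "z \<in> S" "s (Suc j) - inverse (real (Suc j)) < u j (\<psi> z)"
      by (auto simp: u_Suc)
    have "holomorphic_several S (\<lambda>z. g ((\<psi> ^^ Suc j) z))"
      using holomorphic_several_compose[OF holomorphic_map_funpow[OF \<psi> self] g] powS by blast
    then have "holomorphic_several S (\<lambda>z. of_real (s j) - g ((\<psi> ^^ Suc j) z))"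
      using holomorphic_several_affine[of S _ "of_real (s j)" "- 1"] by simp
    then have "Re (of_real (s j) - g ((\<psi> ^^ Suc j) y))
        \<le> H * Re (of_real (s j) - g ((\<psi> ^^ Suc j) (\<psi> z)))"
      using u_le img z(1) y unfolding u_def by (intro harnack) auto
    also have "\<dots> = H * (s j - u j (\<psi> z))" by (simp add: u_def)
    also have "\<dots> \<le> H * (s j - s (Suc j) + inverse (real (Suc j)))"
      using z(2) H by (intro mult_left_mono) auto
    finally show ?thesis by (simp add: u_def)
  qed
  have lim: "(\<lambda>j. s j - H * (s j - s (Suc j) + inverse (real (Suc j)))) \<longlonglongrightarrow> t - H * (t - t + 0)"
    by (intro tendsto_intros t LIMSEQ_Suc[OF t] LIMSEQ_inverse_real_of_nat)
  show thesis
  proof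
    fix y assume y: "y \<in> C"
    have "(\<lambda>j. u j y) \<longlonglongrightarrow> t"
    proof (rule tendsto_sandwich[OF always_eventually always_eventually _ t])
      show "\<forall>j. s j - H * (s j - s (Suc j) + inverse (real (Suc j))) \<le> u j y"
        using lower[OF y] by blast
      show "\<forall>j. u j y \<le> s j" using u_le y assms(4) by blast
      show "(\<lambda>j. s j - H * (s j - s (Suc j) + inverse (real (Suc j)))) \<longlonglongrightarrow> t"
        using lim by simp
    qed
    then show "(\<lambda>j. Re (g ((\<psi> ^^ j) y))) \<longlonglongrightarrow> t"
      unfolding u_def by (rule LIMSEQ_imp_Suc)
  qed
qed

text \<open>The preceding lemma, applied to a coordinate \<open>z\<^sub>i\<close> and to \<open>- \<i> z\<^sub>i\<close>, yields convergence of
  the real and the imaginary parts of the coordinates of \<open>\<psi>\<^sup>j y\<close>, hence of the orbits themselves,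
  to one point common to all of \<open>C\<close>.\<close>

theorem earle_hamilton:
  fixes \<psi> :: "complex ^ 'n \<Rightarrow> complex ^ 'n"
  assumes "open S" and "compact C" and "convex C" and "C \<subseteq> S" and "C \<noteq> {}"
    and \<psi>: "holomorphic_map S \<psi>" and img: "\<psi> ` S \<subseteq> C"
  shows "\<exists>!x. x \<in> S \<and> \<psi> x = x"
proof -
  have "\<exists>l. \<forall>y\<in>C. (\<lambda>j. (\<psi> ^^ j) y $ i) \<longlonglongrightarrow> l" for i
  proof -
    have g: "holomorphic_several S (\<lambda>z. c * (z $ i))" for c
      using holomorphic_several_affine[OF holomorphic_several_coordinate, of S 0 c i] by simp
    obtain a where a: "\<And>y. y \<in> C \<Longrightarrow> (\<lambda>j. Re (1 * ((\<psi> ^^ j) y $ i))) \<longlonglongrightarrow> a"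
      using iterates_compact_image_converge[OF assms g[of 1]] by blast
    obtain b where b: "\<And>y. y \<in> C \<Longrightarrow> (\<lambda>j. Re (- \<i> * ((\<psi> ^^ j) y $ i))) \<longlonglongrightarrow> b"
      using iterates_compact_image_converge[OF assms g[of "- \<i>"]] by blast
    have "(\<lambda>j. (\<psi> ^^ j) y $ i) \<longlonglongrightarrow> Complex a b" if "y \<in> C" for y
      using a[OF that] b[OF that] by (simp add: tendsto_complex_iff)
    then show ?thesis by blast
  qed
  then obtain l where l: "\<And>i y. y \<in> C \<Longrightarrow> (\<lambda>j. (\<psi> ^^ j) y $ i) \<longlonglongrightarrow> l i"
    by metis
  define x where "x = (\<chi> i. l i)"
  have x: "(\<lambda>j. (\<psi> ^^ j) y) \<longlonglongrightarrow> x" if "y \<in> C" for y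
    using l[OF that] by (intro vec_tendstoI) (simp add: x_def)
  have powC: "(\<psi> ^^ j) y \<in> C" if "y \<in> C" for j y
    using that img assms(4) by (induction j) auto
  obtain y0 where y0: "y0 \<in> C" using assms(5) by blast
  have xC: "x \<in> C"
    using closed_sequentially[OF compact_imp_closed[OF assms(2)] _ x[OF y0]] powC[OF y0] by blast
  have "(\<lambda>j. \<psi> ((\<psi> ^^ j) y0)) \<longlonglongrightarrow> \<psi> x"
    using continuous_on_tendsto_compose[OF holomorphic_map_continuous_on[OF \<psi>] x[OF y0]]
      powC[OF y0] xC assms(4) by (auto intro: always_eventually)
  moreover have "(\<lambda>j. \<psi> ((\<psi> ^^ j) y0)) \<longlonglongrightarrow> x"
    using LIMSEQ_Suc[OF x[OF y0]] by simp
  ultimately have x_fixed: "\<psi> x = x" by (rule LIMSEQ_unique)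
  have "z = x" if z: "z \<in> S" "\<psi> z = z" for z
  proof -
    have "z \<in> C" using z img by force
    moreover have "(\<psi> ^^ j) z = z" for j using z(2) by (induction j) auto
    ultimately show ?thesis using x[of z] LIMSEQ_unique[OF tendsto_const] by auto
  qed
  with xC x_fixed assms(4) show ?thesis by blast
qed

section \<open>Absorbing compact sets\<close>

text \<open>By compactness the time in which points of a compact set first reach \<open>L\<close> is bounded. Applied
  to \<open>\<phi> ` L\<close> this bounds the return time to \<open>L\<close> by some \<open>J + 1\<close>, so the images of \<open>L\<close> under the
  first \<open>J\<close> iterates already form an invariant set.\<close>

lemma recurrent_imp_absorbing_compact:
  fixes \<phi> :: "'a::t2_space \<Rightarrow> 'a"
  assumes D: "open D" and cont: "continuous_on D \<phi>" and self: "\<phi> ` D \<subseteq> D"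
    and V: "open V" "V \<subseteq> L" and L: "compact L" "L \<subseteq> D"
    and hit: "\<And>z. z \<in> D \<Longrightarrow> \<exists>j. (\<phi> ^^ j) z \<in> V"
  obtains M where "compact M" and "L \<subseteq> M" and "M \<subseteq> D" and "\<phi> ` M \<subseteq> M"
    and "\<And>Q. compact Q \<Longrightarrow> Q \<subseteq> D \<Longrightarrow> \<exists>k. (\<phi> ^^ k) ` Q \<subseteq> M"
proof -
  have powD: "(\<phi> ^^ j) z \<in> D" if "z \<in> D" for j z
    using that self by (induction j) auto
  have pow_cont: "continuous_on D (\<phi> ^^ j)" for j
  proof (induction j)
    case (Suc j)
    have "continuous_on ((\<phi> ^^ j) ` D) \<phi>"
      using powD by (intro continuous_on_subset[OF cont] image_subsetI)
    then show ?case
      using continuous_on_compose[OF Suc] by (simp only: funpow.simps)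
  qed (simp add: id_def)
  have uniform: "\<exists>J. \<forall>z\<in>Q. \<exists>j\<le>J. (\<phi> ^^ j) z \<in> L" if Q: "compact Q" "Q \<subseteq> D" for Q
  proof -
    have op: "open (D \<inter> (\<phi> ^^ j) -` V)" for j
      using continuous_open_preimage[OF pow_cont D V(1)] .
    have cover: "Q \<subseteq> (\<Union>j\<in>UNIV. D \<inter> (\<phi> ^^ j) -` V)"
    proof
      fix z assume "z \<in> Q"
      then have "z \<in> D" using Q(2) by blast
      with hit obtain j where "(\<phi> ^^ j) z \<in> V" by meson
      with \<open>z \<in> D\<close> show "z \<in> (\<Union>j\<in>UNIV. D \<inter> (\<phi> ^^ j) -` V)"
        by (intro UN_I[of j]) simp_all
    qed
    obtain I where I: "finite I" "Q \<subseteq> (\<Union>j\<in>I. D \<inter> (\<phi> ^^ j) -` V)"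
      by (rule compactE_image[OF Q(1) op cover]) blast
    have "\<exists>j\<le>Max I. (\<phi> ^^ j) z \<in> L" if "z \<in> Q" for z
    proof -
      from that I(2) obtain j where "j \<in> I" "(\<phi> ^^ j) z \<in> V" by auto
      then show ?thesis using V(2) Max_ge[OF I(1)] by (intro exI[of _ j]) auto
    qed
    then show ?thesis by (intro exI[of _ "Max I"]) simp
  qed
  have "compact (\<phi> ` L)" "\<phi> ` L \<subseteq> D"
    using L cont self by (auto intro: compact_continuous_image continuous_on_subset)
  from uniform[OF this] obtain J
    where J: "\<And>z. z \<in> L \<Longrightarrow> \<exists>j\<le>J. (\<phi> ^^ j) (\<phi> z) \<in> L" by blast
  define M where "M = (\<Union>i\<le>J. (\<phi> ^^ i) ` L)"
  have return: "\<phi> z \<in> M" if "z \<in> M" for z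
  proof -
    from that obtain i where "i \<in> {..J}" and "z \<in> (\<phi> ^^ i) ` L"
      unfolding M_def by (rule UN_E)
    then obtain x where i: "i \<le> J" and x: "x \<in> L" and z: "z = (\<phi> ^^ i) x" by auto
    show ?thesis
    proof (cases "i < J")
      case True
      have "\<phi> z = (\<phi> ^^ Suc i) x" by (simp add: z)
      then have "\<phi> z \<in> (\<phi> ^^ Suc i) ` L" using x by (rule image_eqI)
      then show ?thesis unfolding M_def using True by (intro UN_I[of "Suc i"]) simp_all
    next
      case False
      then have iJ: "i = J" using i by simp
      obtain j where j: "j \<le> J" "(\<phi> ^^ j) (\<phi> x) \<in> L" using J[OF x] by blast
      have "\<phi> z = (\<phi> ^^ (J - j + Suc j)) x" using j(1) by (simp add: z iJ)
      also have "\<dots> = (\<phi> ^^ (J - j)) ((\<phi> ^^ j) (\<phi> x))"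
        by (simp only: funpow_add funpow_Suc_right o_apply)
      finally have "\<phi> z \<in> (\<phi> ^^ (J - j)) ` L" using j(2) by (rule image_eqI)
      then show ?thesis unfolding M_def by (intro UN_I[of "J - j"]) simp_all
    qed
  qed
  then have self_M: "\<phi> ` M \<subseteq> M" by blast
  have powM: "(\<phi> ^^ n) z \<in> M" if "z \<in> M" for n z
    using that self_M by (induction n) auto
  show thesis
  proof
    show "compact M"
      unfolding M_def using L pow_cont
      by (intro compact_UN compact_continuous_image) (auto intro: continuous_on_subset)
    show LM: "L \<subseteq> M" unfolding M_def by (intro subsetI UN_I[of 0]) simp_all
    show "M \<subseteq> D" unfolding M_def using L(2) powD by (intro UN_least image_subsetI) blast
    show "\<phi> ` M \<subseteq> M" by (rule self_M)
    fix Q assume "compact Q" "Q \<subseteq> D"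
    from uniform[OF this] obtain k where k: "\<And>z. z \<in> Q \<Longrightarrow> \<exists>j\<le>k. (\<phi> ^^ j) z \<in> L" by blast
    have "(\<phi> ^^ k) z \<in> M" if z: "z \<in> Q" for z
    proof -
      obtain j where j: "j \<le> k" "(\<phi> ^^ j) z \<in> L" using k[OF z] by blast
      have "(\<phi> ^^ k) z = (\<phi> ^^ (k - j + j)) z" using j(1) by simp
      also have "\<dots> = (\<phi> ^^ (k - j)) ((\<phi> ^^ j) z)" by (simp only: funpow_add o_apply)
      finally show ?thesis using powM j(2) LM by auto
    qed
    then show "\<exists>k. (\<phi> ^^ k) ` Q \<subseteq> M" by blast
  qed
qed

text \<open>Convexity of \<open>D\<close> serves to keep the convex hull of \<open>M\<close> inside \<open>D\<close>; the absorbed compact set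
  is a closed neighbourhood of that hull.\<close>

theorem absorbing_imp_unique_fixed_point:
  fixes \<phi> :: "complex ^ 'n \<Rightarrow> complex ^ 'n"
  assumes "open D" and "convex D" and \<phi>: "holomorphic_map D \<phi>" and self: "\<phi> ` D \<subseteq> D"
    and M: "compact M" "M \<noteq> {}" "M \<subseteq> D" "\<phi> ` M \<subseteq> M"
    and absorb: "\<And>Q. compact Q \<Longrightarrow> Q \<subseteq> D \<Longrightarrow> \<exists>k. (\<phi> ^^ k) ` Q \<subseteq> M"
  shows "\<exists>!z. z \<in> D \<and> \<phi> z = z"
proof -
  define C where "C = convex hull M"
  have C: "compact C" "convex C" "M \<subseteq> C" "C \<subseteq> D"
    using M(1,3) assms(2) by (auto simp: C_def compact_convex_hull hull_subset hull_minimal)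
  obtain e where e: "0 < e" "(\<Union>x\<in>C. cball x e) \<subseteq> D"
    using compact_subset_open_imp_cball_epsilon_subset[OF C(1) assms(1) C(4)] by auto
  define S where "S = (\<Union>x\<in>C. ball x e)"
  have S: "open S" "C \<subseteq> S" using e(1) by (auto simp: S_def)
  have Q: "compact (\<Union>x\<in>C. cball x e)"
  proof -
    have "cball x e = (\<Union>y\<in>cball 0 e. {x + y})" for x :: "complex ^ 'n"
    proof (intro set_eqI iffI)
      fix y assume "y \<in> cball x e"
      then have "y - x \<in> cball 0 e" by (simp add: dist_norm norm_minus_commute)
      then show "y \<in> (\<Union>y\<in>cball 0 e. {x + y})" by (intro UN_I[of "y - x"]) auto
    qed (auto simp: dist_norm)
    then have "(\<Union>x\<in>C. cball x e) = (\<Union>x\<in>C. \<Union>y\<in>cball 0 e. {x + y})"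
      by (intro SUP_cong refl)
    then show ?thesis using compact_sums'[OF C(1) compact_cball[of 0 e]] by (simp only:)
  qed
  have SQ: "S \<subseteq> (\<Union>x\<in>C. cball x e)" unfolding S_def using ball_subset_cball by blast
  obtain k where k: "(\<phi> ^^ k) ` (\<Union>x\<in>C. cball x e) \<subseteq> M" using absorb[OF Q e(2)] by blast
  have "holomorphic_map S (\<phi> ^^ k)"
    using holomorphic_map_funpow[OF \<phi> self, of k] SQ e(2)
    unfolding holomorphic_map_def holomorphic_several_def by blast
  moreover have "(\<phi> ^^ k) ` S \<subseteq> C" using k SQ C(3) by blast
  moreover have "C \<noteq> {}" using M(2) C(3) by blast
  ultimately have "\<exists>!x. x \<in> S \<and> (\<phi> ^^ k) x = x"
    using S C(1,2) by (intro earle_hamilton[where C=C])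
  then obtain x where x: "x \<in> S" "(\<phi> ^^ k) x = x"
    and unique: "\<And>y. y \<in> S \<Longrightarrow> (\<phi> ^^ k) y = y \<Longrightarrow> y = x"
    by (elim ex1E) blast
  have "(\<phi> ^^ k) x \<in> M" using x(1) SQ k by blast
  then have xM: "x \<in> M" by (simp only: x(2))
  have "(\<phi> ^^ k) (\<phi> x) = \<phi> x" by (simp only: funpow_swap1[symmetric] x(2))
  moreover have "\<phi> x \<in> S" using xM M(4) C(3) S(2) by blast
  ultimately have "\<phi> x = x" by (intro unique)
  moreover have "y = x" if y: "y \<in> D" "\<phi> y = y" for y
  proof -
    have fixed: "(\<phi> ^^ j) y = y" for j using y(2) by (induction j) auto
    obtain n where "(\<phi> ^^ n) ` {y} \<subseteq> M" using absorb[of "{y}"] y(1) by auto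
    then have "y \<in> M" using fixed[of n] by simp
    then have "y \<in> S" using C(3) S(2) by blast
    then show "y = x" using fixed by (rule unique)
  qed
  ultimately show ?thesis using xM M(3) by blast
qed

section \<open>The kernel near the boundary\<close>

context functional_hilbert_space
begin

lemma diff_mem: "f \<in> Y \<Longrightarrow> g \<in> Y \<Longrightarrow> (\<lambda>z. f z - g z) \<in> Y"
  using add_mem[of f "\<lambda>z. - 1 * g z"] scale_mem[of g "- 1"] by simp

text \<open>This is the Cauchy-Schwarz inequality for \<open>f\<close> and \<open>K z\<close>. It comes from \<open>ip h h \<ge> 0\<close> for
  the combination \<open>h\<close> of \<open>f\<close> and \<open>K z\<close> that vanishes at \<open>z\<close>, that is, which is orthogonal to
  \<open>K z\<close>.\<close>

lemma norm_eval_le_kernel: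
  assumes K: "reproducing_kernel D Y ip K" and z: "z \<in> D" and f: "f \<in> Y"
    and pos: "0 < Re (K z z)"
  shows "norm (f z) \<le> sqrt (Re (K z z)) * ip_norm ip f"
proof -
  have Kz: "K z \<in> Y" and repr: "\<And>f. f \<in> Y \<Longrightarrow> f z = ip f (K z)"
    using K z by (auto simp: reproducing_kernel_def)
  define k where "k = Re (K z z)"
  have "Im (K z z) = 0" and "Im (ip f f) = 0"
    using ip_commute[OF Kz Kz] ip_commute[OF f f] repr[OF Kz] by (auto simp: complex_eq_iff)
  then have k: "K z z = of_real k" and ff: "ip f f = of_real (Re (ip f f))"
    by (auto simp: k_def complex_eq_iff)
  define h where "h = (\<lambda>w. of_real k * f w + (- f z) * K z w)"
  have kf: "(\<lambda>w. of_real k * f w) \<in> Y" and fK: "(\<lambda>w. (- f z) * K z w) \<in> Y"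
    using scale_mem[OF f] scale_mem[OF Kz] by blast+
  have h: "h \<in> Y" unfolding h_def using kf fK by (rule add_mem)
  have ip_h: "ip h g = of_real k * ip f g - f z * ip (K z) g" if g: "g \<in> Y" for g
  proof -
    have "ip h g = ip (\<lambda>w. of_real k * f w) g + ip (\<lambda>w. (- f z) * K z w) g"
      unfolding h_def by (rule ip_add_left[OF kf fK g])
    then show ?thesis by (simp only: ip_scale_left[OF f g] ip_scale_left[OF Kz g]) simp
  qed
  have "h z = 0" by (simp add: h_def k)
  then have "ip (K z) h = 0" using ip_commute[OF Kz h] repr[OF h] by simp
  moreover have "ip f h = of_real k * ip f f - cnj (f z) * f z"
    using ip_commute[OF f h] ip_h[OF f] ip_commute[OF Kz f] repr[OF f] ip_commute[OF f f] by simp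
  ultimately have "ip h h = of_real k * (of_real k * of_real (Re (ip f f)) - of_real ((norm (f z))\<^sup>2))"
    using ip_h[OF h] ff by (simp add: mult.commute flip: complex_norm_square)
  also have "\<dots> = of_real (k * (k * Re (ip f f) - (norm (f z))\<^sup>2))" by simp
  finally have "0 \<le> k * (k * Re (ip f f) - (norm (f z))\<^sup>2)"
    using ip_nonneg[OF h] by (metis Re_complex_of_real)
  then have "(norm (f z))\<^sup>2 \<le> k * Re (ip f f)"
    using pos by (simp add: k_def zero_le_mult_iff)
  then show ?thesis
    by (simp add: ip_norm_def k_def real_le_rsqrt flip: real_sqrt_mult)
qed

end

lemma polynomial_function_bounded:
  assumes D: "bounded D" and p: "p \<in> polynomial_functions D"
  obtains B where "\<And>z. norm (p z) \<le> B"
proof -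
  obtain c and S :: "('a \<Rightarrow> nat) set" where p_eq:
      "p = zero_ext D (\<lambda>z. \<Sum>\<alpha>\<in>S. c \<alpha> * (\<Prod>i\<in>UNIV. (z $ i) ^ \<alpha> i))"
    using p by (auto simp: polynomial_functions_def)
  let ?q = "\<lambda>z. \<Sum>\<alpha>\<in>S. c \<alpha> * (\<Prod>i\<in>UNIV. (z $ i) ^ \<alpha> i)"
  have "continuous_on (closure D) ?q" by (intro continuous_intros)
  then have "compact (?q ` closure D)" using D by (intro compact_continuous_image) auto
  then have "bounded (?q ` closure D)" by (rule compact_imp_bounded)
  then obtain B where B: "\<And>z. z \<in> closure D \<Longrightarrow> norm (?q z) \<le> B"
    unfolding bounded_iff by blast
  have "norm (p z) \<le> max B 0" for z
    using B[of z] closure_subset[of D] by (auto simp: p_eq zero_ext_def le_max_iff_disj)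
  then show thesis by (rule that)
qed

lemma bounded_away_from_zero_at_boundaryE:
  assumes "bounded_away_from_zero_at_boundary D \<psi>"
  obtains \<nu> \<delta> where "0 < \<nu>" and "0 < \<delta>"
    and "\<And>z. z \<in> D \<Longrightarrow> infdist z (frontier D) < \<delta> \<Longrightarrow> \<nu> \<le> norm (\<psi> z)"
proof -
  obtain \<nu> where \<nu>: "0 < \<nu>" "liminf_at_boundary D (\<lambda>z. norm (\<psi> z)) \<nu>"
    using assms unfolding bounded_away_from_zero_at_boundary_def by blast
  then have "0 < \<nu> / 2" by simp
  with \<nu>(2) obtain \<delta> where \<delta>: "0 < \<delta>"
    "\<bar>(INF z\<in>{z \<in> D. infdist z (frontier D) < \<delta>}. ereal (norm (\<psi> z))) - ereal \<nu>\<bar> < ereal (\<nu> / 2)"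
    unfolding liminf_at_boundary_def by blast
  define I where "I = (INF z\<in>{z \<in> D. infdist z (frontier D) < \<delta>}. ereal (norm (\<psi> z)))"
  have I: "ereal (\<nu> / 2) \<le> I"
    using \<delta>(2) unfolding I_def[symmetric] by (cases I) (auto simp: abs_real_def field_simps split: if_splits)
  show thesis
  proof (rule that[of "\<nu> / 2" \<delta>])
    fix z assume "z \<in> D" "infdist z (frontier D) < \<delta>"
    then have "I \<le> ereal (norm (\<psi> z))" unfolding I_def by (intro INF_lower) auto
    with I have "ereal (\<nu> / 2) \<le> ereal (norm (\<psi> z))" by (rule order_trans)
    then show "\<nu> / 2 \<le> norm (\<psi> z)" by simp
  qed (use \<nu> \<delta> in auto)
qed

text \<open>In other words, the normalised kernels tend weakly to zero. A polynomial is bounded on \<open>D\<close>,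
  so its normalised values tend to zero; the error of approximating \<open>g\<close> by a polynomial is
  controlled uniformly by \<open>norm_eval_le_kernel\<close>.\<close>

lemma (in functional_hilbert_space) normalized_eval_tendsto_zero:
  assumes K: "reproducing_kernel D Y ip K" and D: "bounded D"
    and dense: "dense_in_fhs Y ip (polynomial_functions D)"
    and poly: "polynomial_functions D \<subseteq> Y"
    and z: "\<And>k. z k \<in> D" and inf: "filterlim (\<lambda>k. Re (K (z k) (z k))) at_top sequentially"
    and g: "g \<in> Y"
  shows "(\<lambda>k. g (z k) / of_real (sqrt (Re (K (z k) (z k))))) \<longlonglongrightarrow> 0"
proof -
  define \<kappa> where "\<kappa> k = sqrt (Re (K (z k) (z k)))" for k
  have \<kappa>_top: "filterlim \<kappa> at_top sequentially"
    unfolding \<kappa>_def by (rule filterlim_compose[OF sqrt_at_top inf])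
  show ?thesis
  proof (rule tendstoI)
    fix e :: real assume e: "0 < e"
    obtain p where p: "p \<in> polynomial_functions D" "ip_dist ip g p < e / 2"
      using dense g e unfolding dense_in_fhs_def by (meson half_gt_zero)
    obtain B where B: "\<And>w. norm (p w) \<le> B" using polynomial_function_bounded[OF D p(1)] by blast
    have pY: "p \<in> Y" using p(1) poly by blast
    have "eventually (\<lambda>k. 2 * B / e < \<kappa> k \<and> 0 < \<kappa> k) sequentially"
      using \<kappa>_top by (simp add: filterlim_at_top_dense eventually_conj)
    then show "eventually (\<lambda>k. dist (g (z k) / of_real (sqrt (Re (K (z k) (z k))))) 0 < e) sequentially"
    proof eventually_elim
      case (elim k)
      have "norm (g (z k) - p (z k)) \<le> \<kappa> k * ip_norm ip (\<lambda>w. g w - p w)"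
        using norm_eval_le_kernel[OF K z diff_mem[OF g pY], of k] elim by (simp add: \<kappa>_def)
      also have "\<dots> \<le> \<kappa> k * (e / 2)"
        using p(2) elim by (intro mult_left_mono) (auto simp: ip_dist_def)
      finally have "norm (g (z k)) \<le> \<kappa> k * (e / 2) + B"
        using norm_triangle_ineq[of "g (z k) - p (z k)" "p (z k)"] B[of "z k"] by simp
      also have "\<dots> < \<kappa> k * e" using elim e by (simp add: field_simps)
      finally have "norm (g (z k)) < \<kappa> k * e" .
      then show ?case using elim by (simp add: norm_divide field_simps flip: \<kappa>_def)
    qed
  qed
qed

text \<open>If the estimate failed along \<open>z k\<close>, the unit vectors \<open>F k\<close>, the normalised kernels at
  \<open>\<phi> (z k)\<close>, would satisfy \<open>|W (F k) (z k)| = |\<psi> (z k)| \<parallel>K (\<phi> (z k))\<parallel> \<ge> \<nu> \<parallel>K (z k)\<parallel> / \<surd>2\<close>. But a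
  subsequence of \<open>W (F k)\<close> converges in norm to some \<open>g\<close>, and evaluation at \<open>z k\<close> divided by
  \<open>\<parallel>K (z k)\<parallel>\<close> tends to zero on \<open>g\<close> and is bounded by the norm on the difference. Testing \<open>W\<close>
  itself on these vectors replaces the usual argument with its adjoint. In the proof \<open>\<kappa> k\<close> and
  \<open>\<mu> k\<close> are the norms of the kernels at \<open>z k\<close> and at \<open>\<phi> (z k)\<close>.\<close>

lemma (in functional_hilbert_space) kernel_halving_near_boundary:
  assumes K: "reproducing_kernel D Y ip K" and D: "bounded D"
    and K_inf: "tends_to_infinity_at_boundary D (\<lambda>z. Re (K z z))"
    and dense: "dense_in_fhs Y ip (polynomial_functions D)"
    and poly: "polynomial_functions D \<subseteq> Y"
    and \<psi>: "bounded_away_from_zero_at_boundary D \<psi>" and self: "\<phi> ` D \<subseteq> D"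
    and compact: "compact_operator Y ip (weighted_composition D \<psi> \<phi>)"
  shows "\<exists>\<delta>>0. \<forall>z\<in>D. infdist z (frontier D) < \<delta> \<longrightarrow>
      1 < Re (K z z) \<and> Re (K (\<phi> z) (\<phi> z)) \<le> Re (K z z) / 2"
    (is "?P")
proof (rule ccontr)
  assume "\<not> ?P"
  then have bad: "\<exists>z\<in>D. infdist z (frontier D) < \<delta> \<and>
      \<not> (1 < Re (K z z) \<and> Re (K (\<phi> z) (\<phi> z)) \<le> Re (K z z) / 2)" if "0 < \<delta>" for \<delta>
    using that by blast
  obtain \<nu> \<delta>\<^sub>0 where \<nu>: "0 < \<nu>" "0 < \<delta>\<^sub>0"
      "\<And>z. z \<in> D \<Longrightarrow> infdist z (frontier D) < \<delta>\<^sub>0 \<Longrightarrow> \<nu> \<le> norm (\<psi> z)"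
    using bounded_away_from_zero_at_boundaryE[OF \<psi>] by blast
  obtain \<delta>\<^sub>1 where \<delta>\<^sub>1: "0 < \<delta>\<^sub>1" "\<And>z. z \<in> D \<Longrightarrow> infdist z (frontier D) < \<delta>\<^sub>1 \<Longrightarrow> 1 < Re (K z z)"
    using K_inf unfolding tends_to_infinity_at_boundary_def by (meson zero_less_one)
  define \<delta> where "\<delta> k = min (min \<delta>\<^sub>0 \<delta>\<^sub>1) (inverse (real (Suc k)))" for k
  have \<delta>_pos: "0 < \<delta> k" for k using \<nu> \<delta>\<^sub>1 by (simp add: \<delta>_def)
  have "\<forall>k. \<exists>z\<in>D. infdist z (frontier D) < \<delta> k \<and> Re (K z z) / 2 < Re (K (\<phi> z) (\<phi> z))"
  proof
    fix k
    obtain z where "z \<in> D" "infdist z (frontier D) < \<delta> k"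
      "\<not> (1 < Re (K z z) \<and> Re (K (\<phi> z) (\<phi> z)) \<le> Re (K z z) / 2)"
      using bad[OF \<delta>_pos] by blast
    with \<delta>\<^sub>1(2)[of z] show "\<exists>z\<in>D. infdist z (frontier D) < \<delta> k \<and> Re (K z z) / 2 < Re (K (\<phi> z) (\<phi> z))"
      by (intro bexI[of _ z]) (auto simp: \<delta>_def)
  qed
  then obtain z where z: "\<And>k. z k \<in> D" "\<And>k. infdist (z k) (frontier D) < \<delta> k"
      "\<And>k. Re (K (z k) (z k)) / 2 < Re (K (\<phi> (z k)) (\<phi> (z k)))"
    by metis
  have \<phi>z: "\<phi> (z k) \<in> D" for k using z(1) self by blast
  define \<kappa> where "\<kappa> k = sqrt (Re (K (z k) (z k)))" for k
  define \<mu> where "\<mu> k = sqrt (Re (K (\<phi> (z k)) (\<phi> (z k))))" for k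
  have Kzk: "1 < Re (K (z k) (z k))" for k using \<delta>\<^sub>1(2) z(1,2)[of k] by (auto simp: \<delta>_def)
  have \<kappa>: "0 < \<kappa> k" and \<mu>: "0 < \<mu> k" and \<mu>\<kappa>: "\<kappa> k / sqrt 2 \<le> \<mu> k" for k
    using Kzk[of k] z(3)[of k] by (auto simp: \<kappa>_def \<mu>_def simp flip: real_sqrt_divide)
  have K_top: "filterlim (\<lambda>k. Re (K (z k) (z k))) at_top sequentially"
    unfolding filterlim_at_top_gt[where c=0]
  proof (intro allI impI)
    fix M :: real assume "0 < M"
    then obtain d where d: "0 < d" "\<And>z. z \<in> D \<Longrightarrow> infdist z (frontier D) < d \<Longrightarrow> M < Re (K z z)"
      using K_inf unfolding tends_to_infinity_at_boundary_def by meson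
    have "eventually (\<lambda>k. inverse (real (Suc k)) < d) sequentially"
      using order_tendstoD(2)[OF LIMSEQ_inverse_real_of_nat d(1)] .
    then show "eventually (\<lambda>k. M \<le> Re (K (z k) (z k))) sequentially"
    proof eventually_elim
      case (elim k)
      then show ?case using d(2)[OF z(1)[of k]] z(2)[of k] by (simp add: \<delta>_def)
    qed
  qed
  define F where "F k = (\<lambda>w. of_real (1 / \<mu> k) * K (\<phi> (z k)) w)" for k
  have K\<phi>: "K (\<phi> (z k)) \<in> Y" for k using K \<phi>z by (auto simp: reproducing_kernel_def)
  have F_mem: "F k \<in> Y" for k unfolding F_def by (rule scale_mem[OF K\<phi>])
  have F_eval: "F k (\<phi> (z k)) = of_real (\<mu> k)" for k
  proof -
    have "K (\<phi> (z k)) (\<phi> (z k)) = ip (K (\<phi> (z k))) (K (\<phi> (z k)))"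
      using K \<phi>z by (auto simp: reproducing_kernel_def)
    then have "Im (K (\<phi> (z k)) (\<phi> (z k))) = 0"
      using ip_commute[OF K\<phi> K\<phi>, of k k] by (auto simp: complex_eq_iff)
    moreover have "(\<mu> k)\<^sup>2 = Re (K (\<phi> (z k)) (\<phi> (z k)))"
      using \<mu>[of k] by (simp add: \<mu>_def)
    ultimately have "K (\<phi> (z k)) (\<phi> (z k)) = of_real ((\<mu> k)\<^sup>2)" by (simp add: complex_eq_iff)
    then show ?thesis using \<mu>[of k] by (simp add: F_def power2_eq_square)
  qed
  have F_norm: "ip_norm ip (F k) = 1" for k
  proof -
    have "ip (F k) (F k) = of_real (1 / \<mu> k) * ip (K (\<phi> (z k))) (F k)"
      using ip_scale_left[OF K\<phi> F_mem, of "of_real (1 / \<mu> k)" k k] by (simp only: F_def)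
    also have "ip (K (\<phi> (z k))) (F k) = cnj (F k (\<phi> (z k)))"
      using ip_commute[OF K\<phi> F_mem] K \<phi>z F_mem by (simp add: reproducing_kernel_def)
    finally show ?thesis using \<mu>[of k] by (simp add: F_eval ip_norm_def)
  qed
  let ?W = "weighted_composition D \<psi> \<phi>"
  have "(\<forall>k. F k \<in> Y) \<and> (\<exists>C. \<forall>k. ip_norm ip (F k) \<le> C)" using F_mem F_norm by auto
  then obtain r g where r: "strict_mono r" and g: "g \<in> Y"
      and lim: "(\<lambda>k. ip_dist ip (?W (F (r k))) g) \<longlonglongrightarrow> 0"
    using compact unfolding compact_operator_def by blast
  have WF: "?W (F k) \<in> Y" for k using compact F_mem unfolding compact_operator_def by blast
  have "(\<lambda>k. g (z (r k)) / of_real (\<kappa> (r k))) \<longlonglongrightarrow> 0"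
    using normalized_eval_tendsto_zero[OF K D dense poly _ _ g, of "\<lambda>k. z (r k)"] z(1)
      filterlim_compose[OF K_top filterlim_subseq[OF r]] by (simp add: \<kappa>_def)
  then have lim0: "(\<lambda>k. ip_dist ip (?W (F (r k))) g + norm (g (z (r k)) / of_real (\<kappa> (r k)))) \<longlonglongrightarrow> 0 + 0"
    by (intro tendsto_add lim tendsto_norm_zero)
  have "\<nu> / sqrt 2 \<le> ip_dist ip (?W (F (r k))) g + norm (g (z (r k)) / of_real (\<kappa> (r k)))" for k
  proof -
    let ?z = "z (r k)"
    have "\<nu> * (\<kappa> (r k) / sqrt 2) \<le> norm (\<psi> ?z) * \<mu> (r k)"
      using \<nu>(1,3) z(1) z(2)[of "r k"] \<mu>\<kappa> \<kappa>[of "r k"] by (intro mult_mono) (auto simp: \<delta>_def)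
    also have "\<dots> = norm (?W (F (r k)) ?z)"
      using z(1) \<mu>[of "r k"] by (simp add: weighted_composition_def zero_ext_def F_eval norm_mult)
    also have "\<dots> \<le> norm (?W (F (r k)) ?z - g ?z) + norm (g ?z)"
      using norm_triangle_ineq[of "?W (F (r k)) ?z - g ?z" "g ?z"] by simp
    also have "norm (?W (F (r k)) ?z - g ?z) \<le> \<kappa> (r k) * ip_dist ip (?W (F (r k))) g"
      using norm_eval_le_kernel[OF K z(1) diff_mem[OF WF g], of "r k" "r k"] Kzk[of "r k"]
      by (simp add: \<kappa>_def ip_dist_def)
    finally show ?thesis using \<kappa>[of "r k"] by (simp add: norm_divide field_simps)
  qed
  then have "\<nu> / sqrt 2 \<le> 0"
    using lim0 by (intro LIMSEQ_le_const[of _ _ "\<nu> / sqrt 2"]) auto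
  with \<nu>(1) show False by (simp add: divide_le_0_iff)
qed

section \<open>Recurrence and the fixed point\<close>

text \<open>An orbit that stayed within distance \<open>\<delta>\<close> of the boundary would have its values of \<open>u\<close> halved
  at each step, while they have to remain above \<open>1\<close>.\<close>

lemma orbit_hits_interior:
  fixes u :: "'a::metric_space \<Rightarrow> real"
  assumes self: "\<phi> ` D \<subseteq> D" and z: "z \<in> D" and "0 < \<delta>"
    and half: "\<And>z. z \<in> D \<Longrightarrow> infdist z (frontier D) < \<delta> \<Longrightarrow> 1 < u z \<and> u (\<phi> z) \<le> u z / 2"
  shows "\<exists>j. \<delta> / 2 < infdist ((\<phi> ^^ j) z) (frontier D)"
proof (rule ccontr)
  assume "\<not> ?thesis"
  then have "infdist ((\<phi> ^^ j) z) (frontier D) \<le> \<delta> / 2" for j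
    by (simp add: not_less)
  moreover have "\<delta> / 2 < \<delta>" using \<open>0 < \<delta>\<close> by simp
  ultimately have near: "infdist ((\<phi> ^^ j) z) (frontier D) < \<delta>" for j
    by (rule order_le_less_trans)
  have powD: "(\<phi> ^^ j) z \<in> D" for j
    using z self by (induction j) auto
  have decay: "u ((\<phi> ^^ j) z) \<le> u z / 2 ^ j" for j
  proof (induction j)
    case (Suc j)
    have "u ((\<phi> ^^ Suc j) z) \<le> u ((\<phi> ^^ j) z) / 2" using half[OF powD near, of j] by simp
    also have "\<dots> \<le> (u z / 2 ^ j) / 2" using Suc by simp
    finally show ?case by (simp add: mult.commute)
  qed simp
  obtain j where "u z < 2 ^ j"
    using real_arch_pow[of 2 "u z"] by auto
  then have "u z / 2 ^ j < 1" by simp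
  with decay[of j] have "u ((\<phi> ^^ j) z) < 1" by (rule order_le_less_trans)
  moreover have "1 < u ((\<phi> ^^ j) z)" using half[OF powD near, of j] by blast
  ultimately show False by simp
qed

lemma compact_infdist_frontier_ge:
  fixes D :: "'a::heine_borel set"
  assumes "open D" and "bounded D" and "0 < \<delta>"
  shows "compact {z \<in> D. \<delta> \<le> infdist z (frontier D)}"
proof -
  have "{z \<in> D. \<delta> \<le> infdist z (frontier D)} = closure D \<inter> {z. \<delta> \<le> infdist z (frontier D)}"
  proof -
    have "z \<in> D" if "z \<in> closure D" "\<delta> \<le> infdist z (frontier D)" for z
      using that assms by (cases "z \<in> frontier D") (auto simp: frontier_def interior_open)
    then show ?thesis using closure_subset by blast
  qed
  moreover have "closed {z. \<delta> \<le> infdist z (frontier D)}"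
    by (intro closed_Collect_le continuous_intros)
  ultimately show ?thesis using assms(2) by (simp add: compact_Int_closed)
qed

theorem theorem3p1:
  fixes D :: "(complex ^ 'n) set"
    and Y :: "(complex ^ 'n \<Rightarrow> complex) set"
    and ip :: "(complex ^ 'n \<Rightarrow> complex) \<Rightarrow> (complex ^ 'n \<Rightarrow> complex) \<Rightarrow> complex"
    and K :: "complex ^ 'n \<Rightarrow> complex ^ 'n \<Rightarrow> complex"
    and \<psi> :: "complex ^ 'n \<Rightarrow> complex"
    and \<phi> :: "complex ^ 'n \<Rightarrow> complex ^ 'n"
  assumes "open D" and "connected D" and "D \<noteq> {}" and "bounded D" and "convex D"
    and "functional_hilbert_space D Y ip"
    and "reproducing_kernel D Y ip K"
    and "tends_to_infinity_at_boundary D (\<lambda>z. Re (K z z))"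
    and "polynomial_functions D \<subseteq> Y"
    and "dense_in_fhs Y ip (polynomial_functions D)"
    and "holomorphic_several D \<psi>"
    and "bounded_away_from_zero_at_boundary D \<psi>"
    and "holomorphic_map D \<phi>" and "\<phi> ` D \<subseteq> D"
    and "compact_operator Y ip (weighted_composition D \<psi> \<phi>)"
  shows "\<exists>!z. z \<in> D \<and> \<phi> z = z"
proof -
  interpret functional_hilbert_space D Y ip by fact
  obtain \<delta> where \<delta>: "0 < \<delta>" and half: "\<And>z. z \<in> D \<Longrightarrow> infdist z (frontier D) < \<delta> \<Longrightarrow>
      1 < Re (K z z) \<and> Re (K (\<phi> z) (\<phi> z)) \<le> Re (K z z) / 2"
    using kernel_halving_near_boundary[OF assms(7,4,8,10,9,12,14,15)] by blast
  define L where "L = {z \<in> D. \<delta> / 2 \<le> infdist z (frontier D)}"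
  define V where "V = D \<inter> {z. \<delta> / 2 < infdist z (frontier D)}"
  have L: "compact L" "L \<subseteq> D"
    using compact_infdist_frontier_ge[OF assms(1,4), of "\<delta> / 2"] \<delta> by (auto simp: L_def)
  have V: "open V" "V \<subseteq> L"
    unfolding V_def L_def by (auto intro!: open_Int assms(1) open_Collect_less continuous_intros)
  have hit: "\<exists>j. (\<phi> ^^ j) z \<in> V" if z: "z \<in> D" for z
  proof -
    have "(\<phi> ^^ j) z \<in> D" for j using z assms(14) by (induction j) auto
    then show ?thesis
      using orbit_hits_interior[of \<phi> D z \<delta> "\<lambda>z. Re (K z z)", OF assms(14) z \<delta> half]
      by (auto simp: V_def)
  qed
  obtain M where M: "compact M" "L \<subseteq> M" "M \<subseteq> D" "\<phi> ` M \<subseteq> M"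
    "\<And>Q. compact Q \<Longrightarrow> Q \<subseteq> D \<Longrightarrow> \<exists>k. (\<phi> ^^ k) ` Q \<subseteq> M"
    using recurrent_imp_absorbing_compact[OF assms(1)
        holomorphic_map_continuous_on[OF assms(13)] assms(14) V L hit] by metis
  have "M \<noteq> {}" using assms(3) hit V(2) M(2) by blast
  then show ?thesis
    using absorbing_imp_unique_fixed_point[OF assms(1,5,13,14) M(1) _ M(3,4,5)] by blast
qed

end
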